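(* Let $a,b,c,d,e$ be circles in the plane. If $abc\to d$ is tight and the implications $ad\to e$, $bd\to e$, $cd\to e$ hold, then $d\to e$ holds.
   Context: A circle means a closed disc in $\mathbb{R}^2$ (boundary included), possibly of radius $0$; a circle is identified with its point set. For a set $Y$ of circles (written as a word), $\mathrm{CH}(Y)$ is the convex hull of the union of their point sets, and the implication $Y\to u$ means $u\subseteq \mathrm{CH}(Y)$ (so $d\to e$ means $e\subseteq d$). It is tight if it holds and $u\not\subseteq\mathrm{CH}(Y\setminus\{z\})$ for every $z\in Y$. *)

theory Defs
  imports "HOL-Analysis.Analysis"
begin

definition is_circle :: "(real^2) set \<Rightarrow> bool"
  where "is_circle S \<longleftrightarrow> (\<exists>p r. 0 \<le> r \<and> S = cball p r)"

definition CH :: "(real^2) set set \<Rightarrow> (real^2) set"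
  where "CH Y = convex hull (\<Union>Y)"

definition circ_imp :: "(real^2) set set \<Rightarrow> (real^2) set \<Rightarrow> bool"  (infix "\<leadsto>" 50)
  where "Y \<leadsto> u \<longleftrightarrow> u \<subseteq> CH Y"

(* Y is a set, so {a, b, c} represents the three-letter word abc only when a, b, c are
   pairwise distinct; otherwise "tight {a, b, c} d" silently collapses to a statement
   about one or two circles. *)
definition tight :: "(real^2) set set \<Rightarrow> (real^2) set \<Rightarrow> bool"
  where "tight Y u \<longleftrightarrow> Y \<leadsto> u \<and> (\<forall>z\<in>Y. \<not> (Y - {z} \<leadsto> u))"

end

theory Submission
  imports Defs
begin

text \<open>
  If \<open>d \<leadsto> e\<close> fails, some unit vector \<open>v\<close> separates a point of \<open>e\<close> strictly from \<open>d\<close>, and the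
  hypotheses force the support functions of \<open>a\<close>, \<open>b\<close>, \<open>c\<close> to exceed that of \<open>d\<close> at \<open>v\<close>. For each
  of these three circles consider the unit vectors where its support function is smaller than that
  of \<open>d\<close>. Since the support functions of discs are affine on the unit circle, these are arcs, and
  they avoid \<open>v\<close>, so stereographic projection from \<open>v\<close> turns them into intervals. Tightness says
  that the arcs meet pairwise but have no common point, contradicting Helly's theorem on the line.
\<close>

section \<open>Intervals and quadratics on the real line\<close>

lemma helly_real:
  fixes S T U :: "real set"
  assumes "is_interval S" "is_interval T" "is_interval U"
    and "S \<inter> T \<noteq> {}" "T \<inter> U \<noteq> {}" "S \<inter> U \<noteq> {}"
  shows "S \<inter> T \<inter> U \<noteq> {}"
proof -
  obtain x y z where "x \<in> S" "x \<in> T" "y \<in> T" "y \<in> U" "z \<in> S" "z \<in> U"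
    using assms(4-6) by blast
  \<comment> \<open>The median of \<open>x\<close>, \<open>y\<close>, \<open>z\<close> works: each
    set contains two of the three points, and the median is one of these or lies between
    them.\<close>
  then show ?thesis
    using assms(1-3) unfolding is_interval_1 by (smt (verit) IntI empty_iff)
qed

lemma is_interval_quadratic_neg:
  fixes \<alpha> \<beta> \<gamma> :: real
  assumes "0 \<le> \<alpha>"
  shows "is_interval {t. \<alpha> * t\<^sup>2 + \<beta> * t + \<gamma> < 0}"
  unfolding is_interval_1
proof (clarsimp, rule ccontr)
  fix x y z
  assume x: "\<alpha> * x\<^sup>2 + \<beta> * x + \<gamma> < 0" and y: "\<alpha> * y\<^sup>2 + \<beta> * y + \<gamma> < 0"
    and "x \<le> z" "z \<le> y" and z: "\<not> \<alpha> * z\<^sup>2 + \<beta> * z + \<gamma> < 0"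
  \<comment> \<open>The second factor is the slope of the secant over \<open>x\<close>,
    \<open>z\<close>. It is positive while the slope over \<open>z\<close>, \<open>y\<close> is
    negative, although slopes cannot decrease when 0 \<le> \<alpha>.\<close>
  have "0 < (z - x) * (\<alpha> * (z + x) + \<beta>)"
    using x z by (simp add: algebra_simps power2_eq_square)
  then have "0 < \<alpha> * (z + x) + \<beta>"
    using \<open>x \<le> z\<close> by (simp add: zero_less_mult_iff)
  moreover have "(y - z) * (\<alpha> * (y + z) + \<beta>) < 0"
    using y z by (simp add: algebra_simps power2_eq_square)
  then have "\<alpha> * (y + z) + \<beta> < 0"
    using \<open>z \<le> y\<close> by (simp add: mult_less_0_iff)
  moreover have "\<alpha> * x \<le> \<alpha> * y"
    using assms \<open>x \<le> z\<close> \<open>z \<le> y\<close> by (intro mult_left_mono) auto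
  ultimately show False
    by (simp add: algebra_simps)
qed

section \<open>Stereographic projection and arcs of the unit circle\<close>

definition perp :: "real^2 \<Rightarrow> real^2"
  where "perp v = vector [- v$2, v$1]"

text \<open>For a unit vector \<open>v\<close> this is inverse stereographic projection from
  \<open>v\<close>: \<open>t = 0\<close> gives \<open>- v\<close>, and \<open>v\<close> itself is
  only the limit at infinity.\<close>

definition stereo :: "real^2 \<Rightarrow> real \<Rightarrow> real^2"
  where "stereo v t = ((t\<^sup>2 - 1) / (t\<^sup>2 + 1)) *\<^sub>R v + (2 * t / (t\<^sup>2 + 1)) *\<^sub>R perp v"

lemma sq_add_1_pos: "0 < (t::real)\<^sup>2 + 1"
  by (simp add: add_nonneg_pos)

lemma inner_perp_self: "v \<bullet> perp v = 0"
  by (simp add: perp_def inner_vec_def sum_2)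

lemma norm_perp: "norm (perp v) = norm v"
  by (simp add: perp_def norm_vec_def L2_set_def sum_2 add.commute)

lemma norm_stereo:
  assumes "norm v = 1"
  shows "norm (stereo v t) = 1"
proof -
  have "v \<bullet> v = 1" "perp v \<bullet> perp v = 1"
    using assms norm_perp[of v] unfolding norm_eq_1[symmetric] by simp_all
  then have "stereo v t \<bullet> stereo v t = ((t\<^sup>2 - 1) / (t\<^sup>2 + 1))\<^sup>2 + (2 * t / (t\<^sup>2 + 1))\<^sup>2"
    by (simp add: stereo_def inner_add_left inner_add_right inner_perp_self
        inner_commute[of "perp v" v] power2_eq_square)
  also have "\<dots> = ((t\<^sup>2 - 1)\<^sup>2 + (2 * t)\<^sup>2) / (t\<^sup>2 + 1)\<^sup>2"
    by (simp add: power_divide add_divide_distrib)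
  also have "(t\<^sup>2 - 1)\<^sup>2 + (2 * t)\<^sup>2 = (t\<^sup>2 + 1)\<^sup>2"
    by algebra
  finally show ?thesis
    using sq_add_1_pos[of t] by (simp add: norm_eq_1)
qed

lemma stereo_surj:
  assumes "norm v = 1" "norm u = 1" "u \<noteq> v"
  obtains t where "u = stereo v t"
proof -
  define x where "x = u \<bullet> v"
  define y where "y = u \<bullet> perp v"
  have vv: "v$1 * v$1 + v$2 * v$2 = 1" and uu: "u$1 * u$1 + u$2 * u$2 = 1"
    using assms(1,2) by (simp_all add: norm_eq_1 inner_vec_def sum_2)
  have x: "x = u$1 * v$1 + u$2 * v$2" and y: "y = u$2 * v$1 - u$1 * v$2"
    by (simp_all add: x_def y_def perp_def inner_vec_def sum_2)
  have u1: "u$1 = x * v$1 - y * v$2" and u2: "u$2 = x * v$2 + y * v$1"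
    using vv unfolding x y by algebra+
  have u: "u = x *\<^sub>R v + y *\<^sub>R perp v"
    using u1 u2 by (simp add: vec_eq_iff forall_2 perp_def)
  have xy: "x\<^sup>2 + y\<^sup>2 = 1"
    using vv uu unfolding x y by algebra
  have "x \<noteq> 1"
  proof
    assume "x = 1"
    with xy have "y = 0" by simp
    with \<open>x = 1\<close> u assms(3) show False by simp
  qed
  \<comment> \<open>The line from \<open>v\<close> through \<open>u\<close> meets the axis spanned
    by \<open>perp v\<close> at \<open>t *\<^sub>R perp v\<close>.\<close>
  define t where "t = y / (1 - x)"
  have t: "t * (1 - x) = y"
    using \<open>x \<noteq> 1\<close> by (simp add: t_def)
  have "(1 - x) * (t\<^sup>2 * (1 - x)) = (1 - x) * (1 + x)"
  proof -
    have "(1 - x) * (t\<^sup>2 * (1 - x)) = (t * (1 - x))\<^sup>2"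
      by algebra
    also have "\<dots> = (1 - x) * (1 + x)"
      unfolding t using xy by algebra
    finally show ?thesis .
  qed
  then have t2: "t\<^sup>2 * (1 - x) = 1 + x"
    using \<open>x \<noteq> 1\<close> by simp
  have "(t\<^sup>2 - 1) / (t\<^sup>2 + 1) = x"
    using sq_add_1_pos[of t] t2 by (simp add: field_simps)
  moreover have "y * (t\<^sup>2 + 1) = t * (t\<^sup>2 * (1 - x) + (1 - x))"
    unfolding t[symmetric] by algebra
  then have "y * (t\<^sup>2 + 1) = 2 * t"
    unfolding t2 by simp
  then have "2 * t / (t\<^sup>2 + 1) = y"
    using sq_add_1_pos[of t] by (simp add: field_simps)
  ultimately have "u = stereo v t"
    using u by (simp add: stereo_def)
  then show thesis
    by (rule that)
qed

text \<open>Clearing the denominator \<open>t\<^sup>2 + 1\<close> leaves a quadratic in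
  \<open>t\<close> whose leading coefficient is the value of the affine function at
  \<open>v\<close>. The assumption that \<open>v\<close> lies off the arc is thus exactly convexity
  of the quadratic.\<close>

lemma is_interval_stereo_arc:
  assumes "0 \<le> v \<bullet> q + k"
  shows "is_interval {t. stereo v t \<bullet> q + k < 0}"
proof -
  have "stereo v t \<bullet> q + k
      = ((v \<bullet> q + k) * t\<^sup>2 + 2 * (perp v \<bullet> q) * t + (k - v \<bullet> q)) / (t\<^sup>2 + 1)" for t
  proof -
    have "stereo v t \<bullet> q + k
        = ((t\<^sup>2 - 1) * (v \<bullet> q) + 2 * t * (perp v \<bullet> q)) / (t\<^sup>2 + 1) + k"
      by (simp add: stereo_def inner_add_left add_divide_distrib)
    then show ?thesis
      using sq_add_1_pos[of t] by (simp add: add_divide_eq_iff algebra_simps)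
  qed
  then have "stereo v t \<bullet> q + k < 0
      \<longleftrightarrow> (v \<bullet> q + k) * t\<^sup>2 + 2 * (perp v \<bullet> q) * t + (k - v \<bullet> q) < 0" for t
    using sq_add_1_pos[of t] by (simp add: divide_less_0_iff)
  then show ?thesis
    using is_interval_quadratic_neg[OF assms, of "2 * (perp v \<bullet> q)" "k - v \<bullet> q"] by simp
qed

text \<open>On the whole circle three arcs can meet pairwise without a common point, by going around
  it. The point \<open>v\<close> missed by all three rules this out.\<close>

lemma arcs_helly:
  fixes v q1 q2 q3 :: "real^2"
  assumes v: "norm v = 1"
    and pos: "0 \<le> v \<bullet> q1 + k1" "0 \<le> v \<bullet> q2 + k2" "0 \<le> v \<bullet> q3 + k3"
    and "\<exists>u. norm u = 1 \<and> u \<bullet> q1 + k1 < 0 \<and> u \<bullet> q2 + k2 < 0"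
    and "\<exists>u. norm u = 1 \<and> u \<bullet> q2 + k2 < 0 \<and> u \<bullet> q3 + k3 < 0"
    and "\<exists>u. norm u = 1 \<and> u \<bullet> q1 + k1 < 0 \<and> u \<bullet> q3 + k3 < 0"
  shows "\<exists>u. norm u = 1 \<and> u \<bullet> q1 + k1 < 0 \<and> u \<bullet> q2 + k2 < 0 \<and> u \<bullet> q3 + k3 < 0"
proof -
  let ?A = "\<lambda>q k. {t. stereo v t \<bullet> q + k < 0}"
  have meet: "?A q k \<inter> ?A q' k' \<noteq> {}"
    if "\<exists>u. norm u = 1 \<and> u \<bullet> q + k < 0 \<and> u \<bullet> q' + k' < 0" and "0 \<le> v \<bullet> q + k" for q q' k k'
  proof -
    from that obtain u where u: "norm u = 1" "u \<bullet> q + k < 0" "u \<bullet> q' + k' < 0" "u \<noteq> v"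
      by force
    then obtain t where "u = stereo v t"
      using stereo_surj[OF v] by blast
    with u show ?thesis by blast
  qed
  have "?A q1 k1 \<inter> ?A q2 k2 \<inter> ?A q3 k3 \<noteq> {}"
    by (intro helly_real is_interval_stereo_arc meet assms)
  then show ?thesis
    using norm_stereo[OF v] by blast
qed

section \<open>Support functions of discs and separation\<close>

lemma inner_le_support_cball:
  fixes u :: "'a::real_inner"
  assumes "norm u = 1" "x \<in> cball p r"
  shows "u \<bullet> x \<le> u \<bullet> p + r"
proof -
  have "u \<bullet> (x - p) \<le> norm u * norm (x - p)"
    by (rule norm_cauchy_schwarz)
  with assms show ?thesis
    by (simp add: inner_diff_right dist_norm norm_minus_commute)
qed

lemma inner_convex_hull_less:
  assumes "x \<in> convex hull S" "\<And>y. y \<in> S \<Longrightarrow> u \<bullet> y < m"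
  shows "u \<bullet> x < m"
  using hull_minimal[of S "{y. u \<bullet> y < m}" convex] assms convex_halfspace_lt[of u m] by auto

text \<open>This is the point where the bound of \<open>inner_le_support_cball\<close> is
  attained.\<close>

lemma support_point_in_cball:
  fixes u :: "'a::real_normed_vector"
  assumes "norm u = 1" "0 \<le> r"
  shows "p + r *\<^sub>R u \<in> cball p r"
  using assms by (simp add: dist_norm)

lemma separate_from_hull_cballs:
  fixes p q1 q2 :: "real^2"
  assumes "0 \<le> r1" "0 \<le> r2" and "\<not> cball p r \<subseteq> convex hull (cball q1 r1 \<union> cball q2 r2)"
  shows "\<exists>u. norm u = 1 \<and> u \<bullet> q1 + r1 < u \<bullet> p + r \<and> u \<bullet> q2 + r2 < u \<bullet> p + r"
proof -
  let ?H = "convex hull (cball q1 r1 \<union> cball q2 r2)"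
  obtain x where x: "x \<in> cball p r" "x \<notin> ?H"
    using assms(3) by blast
  have "closed ?H"
    by (intro compact_imp_closed compact_convex_hull compact_Un compact_cball)
  then obtain w m where w: "w \<bullet> x < m" "\<And>y. y \<in> ?H \<Longrightarrow> m < w \<bullet> y"
    using separating_hyperplane_closed_point[of ?H x] x(2) by auto
  have "q1 \<in> ?H"
    using assms(1) by (simp add: hull_inc)
  \<comment> \<open>For \<open>w = 0\<close> the separation at \<open>x\<close> and at
    \<open>q1\<close> would read \<open>0 < m\<close> and \<open>m < 0\<close>.\<close>
  with w have "w \<noteq> 0"
    by fastforce
  \<comment> \<open>The sign is flipped because \<open>w\<close> puts \<open>x\<close> on the lower
    side of the hull.\<close>
  define u where "u = - w /\<^sub>R norm w"
  have u: "norm u = 1"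
    using \<open>w \<noteq> 0\<close> by (simp add: u_def)
  have sep: "u \<bullet> y < u \<bullet> x" if "y \<in> ?H" for y
    using w(1) w(2)[OF that] \<open>w \<noteq> 0\<close> by (simp add: u_def)
  have "u \<bullet> q + s < u \<bullet> p + r" if "0 \<le> s" "cball q s \<subseteq> ?H" for q s
  proof -
    have "u \<bullet> (q + s *\<^sub>R u) < u \<bullet> x"
      using that support_point_in_cball[OF u] by (intro sep) blast
    also have "u \<bullet> x \<le> u \<bullet> p + r"
      by (rule inner_le_support_cball[OF u x(1)])
    finally show ?thesis
      using u by (simp add: inner_add_right norm_eq_1)
  qed
  moreover have "cball q1 r1 \<subseteq> ?H" "cball q2 r2 \<subseteq> ?H"
    using hull_subset[of "cball q1 r1 \<union> cball q2 r2" convex] by auto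
  ultimately show ?thesis
    using u assms(1,2) by blast
qed

section \<open>Helly applied to the arcs of \<open>a\<close>, \<open>b\<close>, \<open>c\<close>
  relative to \<open>d\<close>\<close>

theorem theorem5p7:
  fixes a b c d e :: "(real^2) set"
  assumes "is_circle a" and "is_circle b" and "is_circle c"
    and "is_circle d" and "is_circle e"
    and "distinct [a, b, c]"
    and "tight {a, b, c} d"
    and "{a, d} \<leadsto> e" and "{b, d} \<leadsto> e" and "{c, d} \<leadsto> e"
  shows "{d} \<leadsto> e"
proof (rule ccontr)
  assume neg: "\<not> {d} \<leadsto> e"
  obtain pa ra where a: "0 \<le> ra" "a = cball pa ra" using assms(1) is_circle_def by auto
  obtain pb rb where b: "0 \<le> rb" "b = cball pb rb" using assms(2) is_circle_def by auto
  obtain pc rc where c: "0 \<le> rc" "c = cball pc rc" using assms(3) is_circle_def by auto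
  obtain pd rd where d: "0 \<le> rd" "d = cball pd rd" using assms(4) is_circle_def by auto
  have "convex hull d = d"
    by (simp add: d(2) convex_hull_eq)
  with neg obtain x where x: "x \<in> e" "x \<notin> d"
    by (auto simp: circ_imp_def CH_def)
  \<comment> \<open>The direction from the centre of \<open>d\<close> to \<open>x\<close> separates
    \<open>x\<close> strictly from \<open>d\<close>.\<close>
  define v where "v = (x - pd) /\<^sub>R norm (x - pd)"
  have far: "rd < norm (x - pd)"
    using x(2) by (simp add: d(2) dist_norm norm_minus_commute)
  then have nz: "norm (x - pd) \<noteq> 0"
    using d(1) by linarith
  then have v: "norm v = 1"
    by (simp add: v_def)
  have "v \<bullet> (x - pd) = norm (x - pd)"
    using nz by (simp add: v_def dot_square_norm power2_eq_square)
  with far have vx: "v \<bullet> pd + rd < v \<bullet> x"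
    by (simp add: inner_diff_right)
  \<comment> \<open>The expression is the difference of the two support functions at
    \<open>v\<close>. Were it negative, the disc would stay below \<open>x\<close> in direction
    \<open>v\<close>, as \<open>d\<close> does, and so would the hull containing
    \<open>e\<close>.\<close>
  have above: "0 \<le> v \<bullet> (p - pd) + (r - rd)" if "{cball p r, d} \<leadsto> e" for p r
  proof (rule ccontr)
    assume less: "\<not> ?thesis"
    have "x \<in> convex hull (cball p r \<union> d)"
      using that x(1) by (auto simp: circ_imp_def CH_def)
    then have "v \<bullet> x < v \<bullet> x"
    proof (rule inner_convex_hull_less)
      fix y assume "y \<in> cball p r \<union> d"
      then have "v \<bullet> y \<le> v \<bullet> p + r \<or> v \<bullet> y \<le> v \<bullet> pd + rd"
        using inner_le_support_cball[OF v] d(2) by blast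
      with less vx show "v \<bullet> y < v \<bullet> x"
        by (auto simp: inner_diff_right)
    qed
    then show False by simp
  qed
  \<comment> \<open>Distinctness ensures that deleting one circle leaves both others.\<close>
  have "{a, b, c} - {a} = {b, c}" "{a, b, c} - {b} = {a, c}" "{a, b, c} - {c} = {a, b}"
    using assms(6) by auto
  then have not_imp: "\<not> {b, c} \<leadsto> d" "\<not> {a, c} \<leadsto> d" "\<not> {a, b} \<leadsto> d"
    using assms(7) unfolding tight_def by (metis insertCI)+
  have pair: "\<exists>u. norm u = 1 \<and> u \<bullet> (p - pd) + (r - rd) < 0 \<and> u \<bullet> (q - pd) + (s - rd) < 0"
    if "\<not> {cball p r, cball q s} \<leadsto> d" "0 \<le> r" "0 \<le> s" for p q r s
    using separate_from_hull_cballs[OF that(2,3), of pd rd p q] that(1) d(2)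
    by (simp add: circ_imp_def CH_def inner_diff_right algebra_simps)
  have "\<exists>u. norm u = 1 \<and> u \<bullet> (pa - pd) + (ra - rd) < 0 \<and> u \<bullet> (pb - pd) + (rb - rd) < 0
      \<and> u \<bullet> (pc - pd) + (rc - rd) < 0"
    using assms(8-10) not_imp a b c by (intro arcs_helly[OF v] above pair) auto
  then obtain u where u: "norm u = 1" "u \<bullet> pa + ra < u \<bullet> pd + rd"
      "u \<bullet> pb + rb < u \<bullet> pd + rd" "u \<bullet> pc + rc < u \<bullet> pd + rd"
    by (auto simp: inner_diff_right)
  \<comment> \<open>The point of \<open>d\<close> extreme in direction \<open>u\<close> lies in the
    hull of three discs that all stay strictly below it.\<close>
  have "pd + rd *\<^sub>R u \<in> convex hull (a \<union> b \<union> c)"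
    using assms(7) support_point_in_cball[OF u(1) d(1), of pd] d(2)
    by (auto simp: tight_def circ_imp_def CH_def Un_assoc)
  then have "u \<bullet> (pd + rd *\<^sub>R u) < u \<bullet> pd + rd"
  proof (rule inner_convex_hull_less)
    fix y assume "y \<in> a \<union> b \<union> c"
    then have "u \<bullet> y \<le> u \<bullet> pa + ra \<or> u \<bullet> y \<le> u \<bullet> pb + rb \<or> u \<bullet> y \<le> u \<bullet> pc + rc"
      using inner_le_support_cball[OF u(1)] a(2) b(2) c(2) by blast
    with u show "u \<bullet> y < u \<bullet> pd + rd"
      by auto
  qed
  then show False
    using u(1) by (simp add: inner_add_right norm_eq_1)
qed

end
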